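(* Consider an agent with starting feature vector $x_0\in\mathbb{R}^n$ facing the classifier $\mathbf{1}(\theta^Tx\ge\theta_0)$, with the quadratic cost $c(x,x_0)=\sum_i c_i(x_i-x_{0,i})^2$, and let $$x_{\mathrm{NB}}:=\arg\max_{x}\; r\,\mathbf{1}(\theta^Tx\ge\theta_0)-c(x,x_0)\quad\text{subject to}\quad c(x,x_0)\le B .$$ Let $C$ denote the diagonal matrix with the $c_i$'s as its diagonal, and let $y$ denote the feature vectors satisfying $\theta^Ty=\theta_0$. If $x_0$ is in the $n$-dimensional ellipsoid described by $B$ and $C$ around such a point, i.e., if $(y-x_0)^TC(y-x_0)\le B$ for some $y$ with $\theta^Ty=\theta_0$, then for every $i$ $$x_{\mathrm{NB},i}=\frac{\theta_0-\theta^Tx_0}{\sum_j\frac{\theta_j^2}{c_j}}\cdot\frac{\theta_i}{c_i}+x_{0,i}.$$ Otherwise, $x_{\mathrm{NB}}=x_0$. For behaviorally biased agents, whose response $x_{\mathrm{B}}$ is the solution of the same problem with $\mathbf{1}(\theta^Tx\ge\theta_0)$ replaced by $\mathbf{1}(w(\theta)^Tx\ge\theta_0)$, $x_{\mathrm{B}}$ is obtained similarly by replacing $\theta$ with $w(\theta)$.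
   Context: Strategic classification: a firm uses the threshold classifier $h(x,(\theta,\theta_0))=\mathbf{1}(\theta^Tx\ge\theta_0)$, where $\mathbf 1(\cdot)$ is the indicator function and $\theta=[\theta_1,\dots,\theta_n]^T$ is the vector of feature weights, normalized so that $\sum_i\theta_i=1$ and interpreted as a probability vector. An agent with initial features $x_0$ changes them to $x$ at cost $c(x,x_0)$, with cost coefficients $c_i$; $r>0$ is the reward of positive classification and $B$ is the agent's budget. A rational ("non-behavioral") agent responds to the true weights $\theta$; a behaviorally biased agent misperceives $\theta$ as $w(\theta)$, where $w(\cdot)$ is a function capturing the agent's biases, and responds to $(w(\theta),\theta_0)$.
   Formalization: The formula is claimed only if also θᵀx0 ≤ θ0 and some y with θᵀy = θ0 costs less than r; if the least such cost equals r, both x0 and the formula are optimal; in all other cases x_NB = x0. Likewise with w(θ) for θ. It is assumed that c_i > 0 and B ≥ 0. *)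

theory Defs
  imports "HOL-Analysis.Analysis"
begin

definition classifier :: "real^'n \<Rightarrow> real \<Rightarrow> real^'n \<Rightarrow> real" where
  "classifier \<theta> \<theta>0 x = (if \<theta> \<bullet> x \<ge> \<theta>0 then 1 else 0)"

definition quad_cost :: "real^'n \<Rightarrow> real^'n \<Rightarrow> real^'n \<Rightarrow> real" where
  "quad_cost c x x0 = (\<Sum>i\<in>UNIV. c $ i * (x $ i - x0 $ i)\<^sup>2)"

definition diag_matrix :: "real^'n \<Rightarrow> real^'n^'n" where
  "diag_matrix c = (\<chi> i j. if i = j then c $ i else 0)"

text \<open>
  The full set of maximizers, so that an equation \<open>best_responses r B c x0 \<theta> \<theta>0 = {x}\<close>
  asserts that the optimization problem has \<open>x\<close> as its unique solution. The weights \<open>\<theta>\<close> are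
  those the agent responds to: the true ones, or the misperceived ones.
\<close>
definition best_responses ::
    "real \<Rightarrow> real \<Rightarrow> real^'n \<Rightarrow> real^'n \<Rightarrow> real^'n \<Rightarrow> real \<Rightarrow> (real^'n) set" where
  "best_responses r B c x0 \<theta> \<theta>0 =
     {x. is_arg_max (\<lambda>x. r * classifier \<theta> \<theta>0 x - quad_cost c x x0)
                    (\<lambda>x. quad_cost c x x0 \<le> B) x}"

end

theory Submission
  imports Defs
begin

text \<open>
  In the inner product weighted by \<open>c\<close>, the displacement from \<open>x0\<close> to its projection onto the
  hyperplane \<open>v \<bullet> x = t\<close> is a nonnegative multiple of the normal direction
  \<open>v $ i / c $ i\<close> as soon as \<open>v \<bullet> x0 \<le> t\<close>. For a positively classified \<open>x\<close> the displacement
  from the projection to \<open>x\<close> has a nonnegative inner product with it, so the cost of \<open>x\<close> is at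
  least that of the projection plus the squared weighted distance between the two: the
  projection is the unique cheapest way to be accepted. The agent then compares the cost of the projection with the
  budget \<open>B\<close> and the reward \<open>r\<close>; staying at \<open>x0\<close> is the unique cheapest choice overall.
\<close>

definition weighted_proj :: "real^'n \<Rightarrow> real^'n \<Rightarrow> real^'n \<Rightarrow> real \<Rightarrow> real^'n" where
  "weighted_proj c x0 v t =
     (\<chi> i. (t - v \<bullet> x0) / (\<Sum>j\<in>UNIV. (v $ j)\<^sup>2 / c $ j) * (v $ i / c $ i) + x0 $ i)"

lemma inner_diag_matrix: "d \<bullet> (diag_matrix c *v d) = (\<Sum>i\<in>UNIV. c $ i * (d $ i)\<^sup>2)"
proof -
  have "(\<Sum>j\<in>UNIV. diag_matrix c $ i $ j * d $ j) = c $ i * d $ i" for i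
    by (simp add: diag_matrix_def if_distrib [of "\<lambda>a. a * _"] sum.delta cong: if_cong)
  then show ?thesis
    by (simp add: inner_vec_def matrix_vector_mult_def power2_eq_square algebra_simps)
qed

text \<open>Turns the ellipsoid condition of the theorem into the budget constraint.\<close>

lemma inner_diag_matrix_eq_quad_cost:
  "(y - x0) \<bullet> (diag_matrix c *v (y - x0)) = quad_cost c y x0"
  by (simp add: inner_diag_matrix quad_cost_def)

lemma quad_cost_self [simp]: "quad_cost c x x = 0"
  by (simp add: quad_cost_def)

lemma quad_cost_nonneg:
  assumes "\<forall>i. 0 < c $ i"
  shows "0 \<le> quad_cost c x y"
  using assms by (auto simp: quad_cost_def intro!: sum_nonneg simp: less_imp_le)

lemma quad_cost_eq_0_iff:
  assumes "\<forall>i. 0 < c $ i"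
  shows "quad_cost c x y = 0 \<longleftrightarrow> x = y"
proof -
  have "quad_cost c x y = 0 \<longleftrightarrow> (\<forall>i. c $ i * (x $ i - y $ i)\<^sup>2 = 0)"
    unfolding quad_cost_def using assms by (subst sum_nonneg_eq_0_iff) (auto simp: less_imp_le)
  then show ?thesis
    using assms by (auto simp: vec_eq_iff less_le)
qed

text \<open>The sum is the denominator in \<open>weighted_proj\<close>, so that formula degenerates
  only for \<open>v = 0\<close>.\<close>

lemma sum_squares_div_eq_0_iff:
  fixes c v :: "real^'n"
  assumes "\<forall>i. 0 < c $ i"
  shows "(\<Sum>j\<in>UNIV. (v $ j)\<^sup>2 / c $ j) = 0 \<longleftrightarrow> v = 0"
proof -
  have "(\<Sum>j\<in>UNIV. (v $ j)\<^sup>2 / c $ j) = 0 \<longleftrightarrow> (\<forall>j. (v $ j)\<^sup>2 / c $ j = 0)"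
    using assms by (subst sum_nonneg_eq_0_iff) (auto simp: less_imp_le)
  then show ?thesis
    using assms by (auto simp: vec_eq_iff less_le)
qed

text \<open>
  The hypothesis also covers the degenerate case \<open>v = 0\<close>: it forces \<open>t = 0\<close>, and the quotient
  \<open>0 / 0 = 0\<close> makes the projection equal to \<open>x0\<close>.
\<close>
lemma inner_weighted_proj:
  assumes "\<forall>i. 0 < c $ i" and "v \<bullet> x0 \<le> t" and "t \<le> v \<bullet> x"
  shows "v \<bullet> weighted_proj c x0 v t = t"
proof (cases "v = 0")
  case True
  then show ?thesis using assms by simp
next
  case False
  define S where "S = (\<Sum>j\<in>UNIV. (v $ j)\<^sup>2 / c $ j)"
  have "S \<noteq> 0"
    using False sum_squares_div_eq_0_iff [OF assms(1)] by (simp add: S_def)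
  have "v \<bullet> weighted_proj c x0 v t
      = (\<Sum>i\<in>UNIV. (t - v \<bullet> x0) / S * ((v $ i)\<^sup>2 / c $ i) + v $ i * x0 $ i)"
    unfolding S_def by (subst inner_vec_def)
      (auto simp: weighted_proj_def power2_eq_square algebra_simps intro!: sum.cong)
  also have "\<dots> = (t - v \<bullet> x0) / S * S + v \<bullet> x0"
    unfolding S_def inner_vec_def by (simp only: sum.distrib sum_distrib_left inner_real_def)
  finally show ?thesis
    using \<open>S \<noteq> 0\<close> by simp
qed

text \<open>A Pythagoras inequality: expanding the cost of \<open>x\<close> around \<open>p\<close>
  leaves the cross term \<open>2 * \<mu> * (v \<bullet> (x - p))\<close>, where both
  \<open>\<mu>\<close> and \<open>v \<bullet> (x - p)\<close> are nonnegative.\<close>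

lemma quad_cost_weighted_proj_le:
  assumes c: "\<forall>i. 0 < c $ i" and "v \<bullet> x0 \<le> t" and "t \<le> v \<bullet> x"
  defines "p \<equiv> weighted_proj c x0 v t"
  shows "quad_cost c p x0 + quad_cost c x p \<le> quad_cost c x x0"
proof -
  \<comment> \<open>Half the Lagrange multiplier of the cost minimization; for \<open>v = 0\<close>
    division by zero makes it \<open>0\<close>, so its sign needs no case split.\<close>
  define \<mu> where "\<mu> = (t - v \<bullet> x0) / (\<Sum>j\<in>UNIV. (v $ j)\<^sup>2 / c $ j)"
  have "0 \<le> \<mu>"
    unfolding \<mu>_def using assms by (intro divide_nonneg_nonneg sum_nonneg) (auto simp: less_imp_le)
  have normal: "c $ i * (p $ i - x0 $ i) = \<mu> * v $ i" for i
    using c [rule_format, of i] by (simp add: p_def weighted_proj_def \<mu>_def)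
  have "c $ i * (x $ i - x0 $ i)\<^sup>2 = c $ i * (p $ i - x0 $ i)\<^sup>2 + c $ i * (x $ i - p $ i)\<^sup>2
      + 2 * \<mu> * (v $ i * (x $ i - p $ i))" for i
  proof -
    have "c $ i * (x $ i - x0 $ i)\<^sup>2 = c $ i * (p $ i - x0 $ i)\<^sup>2 + c $ i * (x $ i - p $ i)\<^sup>2
      + 2 * (c $ i * (p $ i - x0 $ i)) * (x $ i - p $ i)"
      by (simp add: power2_eq_square algebra_simps)
    then show ?thesis by (simp add: normal)
  qed
  then have "quad_cost c x x0 = quad_cost c p x0 + quad_cost c x p + 2 * \<mu> * (v \<bullet> (x - p))"
    by (simp add: quad_cost_def sum.distrib inner_vec_def sum_distrib_left)
  moreover have "v \<bullet> p = t"
    unfolding p_def using assms by (intro inner_weighted_proj)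
  ultimately show ?thesis
    using \<open>0 \<le> \<mu>\<close> assms(3) by (simp add: inner_diff_right)
qed

lemma mem_best_responses_iff:
  "x \<in> best_responses r B c x0 v t \<longleftrightarrow>
     quad_cost c x x0 \<le> B \<and>
     (\<forall>y. quad_cost c y x0 \<le> B \<longrightarrow>
        r * classifier v t y - quad_cost c y x0 \<le> r * classifier v t x - quad_cost c x x0)"
  by (auto simp: best_responses_def is_arg_max_linorder)

text \<open>Staying is free, hence feasible, and earns \<open>r * classifier v t x0\<close>;
  strictness of the bound rules out every other maximizer.\<close>

lemma best_responses_stay:
  assumes "0 \<le> B"
    and le: "\<And>y. quad_cost c y x0 \<le> B \<Longrightarrow> y \<noteq> x0 \<Longrightarrow>
      r * classifier v t y - quad_cost c y x0 < r * classifier v t x0"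
  shows "best_responses r B c x0 v t = {x0}"
proof (rule set_eqI)
  fix x
  show "x \<in> best_responses r B c x0 v t \<longleftrightarrow> x \<in> {x0}"
  proof
    assume "x \<in> best_responses r B c x0 v t"
    then have "quad_cost c x x0 \<le> B"
      and "r * classifier v t x0 \<le> r * classifier v t x - quad_cost c x x0"
      using \<open>0 \<le> B\<close> by (auto simp: mem_best_responses_iff dest: spec [of _ x0])
    with le [of x] show "x \<in> {x0}" by fastforce
  next
    assume "x \<in> {x0}"
    with le \<open>0 \<le> B\<close> show "x \<in> best_responses r B c x0 v t"
      by (fastforce simp: mem_best_responses_iff intro: less_imp_le)
  qed
qed

text \<open>Moving requires that the hyperplane be affordable, that \<open>x0\<close> not lie
  strictly beyond it, and that the reward cover the cost. The middle branch admits the tie, where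
  moving and staying are both optimal.\<close>

lemma best_responses_eq:
  fixes v c x0 :: "real^'n" and t :: real
  assumes c: "\<forall>i. 0 < c $ i" and "0 < r" and "0 \<le> B"
  defines "p \<equiv> weighted_proj c x0 v t"
  shows "best_responses r B c x0 v t =
    (if (\<exists>y. v \<bullet> y = t \<and> quad_cost c y x0 \<le> B) \<and> v \<bullet> x0 \<le> t
        \<and> (\<exists>y. v \<bullet> y = t \<and> quad_cost c y x0 < r)
     then {p}
     else if (\<exists>y. v \<bullet> y = t \<and> quad_cost c y x0 \<le> B) \<and> v \<bullet> x0 \<le> t
        \<and> (\<exists>y. v \<bullet> y = t \<and> quad_cost c y x0 \<le> r)
     then {x0, p}
     else {x0})"
proof -
  note nonneg = quad_cost_nonneg [OF c]
  have pos: "0 < quad_cost c x y" if "x \<noteq> y" for x y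
    using nonneg [of x y] quad_cost_eq_0_iff [OF c, of x y] that by linarith
  show ?thesis
  proof (cases "v \<bullet> x0 \<le> t \<and> (\<exists>y. t \<le> v \<bullet> y \<and> quad_cost c y x0 \<le> B)")
    case False
    \<comment> \<open>Either \<open>x0\<close> already earns the full reward at no cost, or no
      affordable point is accepted and any move only costs.\<close>
    have "best_responses r B c x0 v t = {x0}"
      using False \<open>0 < r\<close> pos
      by (intro best_responses_stay [OF \<open>0 \<le> B\<close>]) (force simp: classifier_def)
    then show ?thesis using False by auto
  next
    case True
    then obtain y0 where y0: "v \<bullet> x0 \<le> t" "t \<le> v \<bullet> y0" "quad_cost c y0 x0 \<le> B"
      by blast
    have p: "v \<bullet> p = t"
      unfolding p_def using c y0 by (intro inner_weighted_proj)
    have opt: "quad_cost c p x0 + quad_cost c x p \<le> quad_cost c x x0" if "t \<le> v \<bullet> x" for x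
      unfolding p_def using c y0(1) that by (intro quad_cost_weighted_proj_le)
    have opt': "quad_cost c p x0 \<le> quad_cost c x x0" if "t \<le> v \<bullet> x" for x
      using opt [OF that] nonneg [of x p] by linarith
    have opt_strict: "quad_cost c p x0 < quad_cost c x x0" if "t \<le> v \<bullet> x" "x \<noteq> p" for x
      using opt [OF that(1)] pos [OF that(2)] by linarith
    have pB: "quad_cost c p x0 \<le> B"
      using opt' [OF y0(2)] y0(3) by linarith
    \<comment> \<open>Since \<open>p\<close> is a cheapest point of the hyperplane, the existential
      conditions reduce to comparisons with its cost.\<close>
    have reach: "(\<exists>y. v \<bullet> y = t \<and> quad_cost c y x0 \<le> b) \<longleftrightarrow> quad_cost c p x0 \<le> b" for b
      using opt' [OF eq_refl [OF sym]] p order_trans [of "quad_cost c p x0" _ b] by blast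
    have reach_strict: "(\<exists>y. v \<bullet> y = t \<and> quad_cost c y x0 < b) \<longleftrightarrow> quad_cost c p x0 < b" for b
      using opt' [OF eq_refl [OF sym]] p le_less_trans [of "quad_cost c p x0" _ b] by blast
    have value_p: "r * classifier v t p = r"
      by (simp add: classifier_def p)
    \<comment> \<open>Were \<open>x0\<close> accepted, \<open>p\<close> could cost no more than
      staying, that is \<open>0\<close>, contradicting \<open>0 < r\<close>.\<close>
    have x0_reject: "v \<bullet> x0 < t" if "r \<le> quad_cost c p x0"
      using opt' [of x0] that \<open>0 < r\<close> by fastforce
    consider "quad_cost c p x0 < r" | "quad_cost c p x0 = r" | "r < quad_cost c p x0"
      by linarith
    then show ?thesis
    proof cases
      case 1
      \<comment> \<open>An accepted \<open>y\<close> costs strictly more than \<open>p\<close>; a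
        rejected one gains at most \<open>0\<close>, less than the net gain at
        \<open>p\<close>.\<close>
      have better: "r * classifier v t y - quad_cost c y x0 < r - quad_cost c p x0"
        if "y \<noteq> p" for y
        using opt_strict [of y] that nonneg [of y x0] 1 by (auto simp: classifier_def)
      have "best_responses r B c x0 v t = {p}"
      proof (rule set_eqI)
        fix x
        show "x \<in> best_responses r B c x0 v t \<longleftrightarrow> x \<in> {p}"
        proof
          assume "x \<in> best_responses r B c x0 v t"
          then have "r - quad_cost c p x0 \<le> r * classifier v t x - quad_cost c x x0"
            using pB value_p by (auto simp: mem_best_responses_iff dest: spec [of _ p])
          then show "x \<in> {p}" using better [of x] by fastforce
        next
          assume "x \<in> {p}"
          then show "x \<in> best_responses r B c x0 v t"
            using better [THEN less_imp_le] pB value_p unfolding mem_best_responses_iff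
            by (metis order_refl singletonD)
        qed
      qed
      then show ?thesis using 1 y0(1) pB by (simp add: reach reach_strict)
    next
      case 2
      have value_x0: "r * classifier v t x0 = 0"
        using x0_reject 2 by (simp add: classifier_def)
      \<comment> \<open>Both \<open>p\<close> and \<open>x0\<close> have value \<open>0\<close>
        here: accepted points other than \<open>p\<close> cost more than \<open>r\<close>, and
        rejected ones other than \<open>x0\<close> cost something for nothing.\<close>
      have worse: "r * classifier v t y - quad_cost c y x0 < 0"
        if "y \<noteq> p" "y \<noteq> x0" for y
        using opt_strict [of y] that pos [of y x0] 2 by (auto simp: classifier_def)
      have le: "r * classifier v t y - quad_cost c y x0 \<le> 0" for y
        using worse [of y] value_p value_x0 2 by fastforce
      have "best_responses r B c x0 v t = {x0, p}"
      proof (rule set_eqI)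
        fix x
        show "x \<in> best_responses r B c x0 v t \<longleftrightarrow> x \<in> {x0, p}"
        proof
          assume "x \<in> best_responses r B c x0 v t"
          then have "0 \<le> r * classifier v t x - quad_cost c x x0"
            using \<open>0 \<le> B\<close> value_x0 by (auto simp: mem_best_responses_iff dest: spec [of _ x0])
          then show "x \<in> {x0, p}" using worse [of x] by fastforce
        next
          assume "x \<in> {x0, p}"
          then show "x \<in> best_responses r B c x0 v t"
            using le value_p value_x0 2 pB \<open>0 \<le> B\<close> by (auto simp: mem_best_responses_iff)
        qed
      qed
      then show ?thesis using 2 y0(1) pB by (simp add: reach reach_strict)
    next
      case 3
      have "best_responses r B c x0 v t = {x0}"
      proof (rule best_responses_stay [OF \<open>0 \<le> B\<close>])
        fix y
        assume "y \<noteq> x0"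
        then show "r * classifier v t y - quad_cost c y x0 < r * classifier v t x0"
          using opt' [of y] pos [of y x0] 3 x0_reject by (auto simp: classifier_def)
      qed
      then show ?thesis using 3 by (simp add: reach reach_strict)
    qed
  qed
qed

theorem lemma2:
  fixes \<theta> c x0 :: "real^'n" and w :: "real^'n \<Rightarrow> real^'n" and \<theta>0 r B :: real
  assumes "\<forall>i. 0 \<le> \<theta> $ i" and "(\<Sum>i\<in>UNIV. \<theta> $ i) = 1"
    and "\<forall>i. 0 < c $ i"
    and "0 < r" and "0 \<le> B"
  shows "(let xhat = (\<chi> i. (\<theta>0 - \<theta> \<bullet> x0) / (\<Sum>j\<in>UNIV. (\<theta> $ j)\<^sup>2 / c $ j)
                             * (\<theta> $ i / c $ i) + x0 $ i)
          in best_responses r B c x0 \<theta> \<theta>0 =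
               (if (\<exists>y. \<theta> \<bullet> y = \<theta>0 \<and> (y - x0) \<bullet> (diag_matrix c *v (y - x0)) \<le> B)
                     \<and> \<theta> \<bullet> x0 \<le> \<theta>0
                     \<and> (\<exists>y. \<theta> \<bullet> y = \<theta>0 \<and> quad_cost c y x0 < r)
                then {xhat}
                else if (\<exists>y. \<theta> \<bullet> y = \<theta>0 \<and> (y - x0) \<bullet> (diag_matrix c *v (y - x0)) \<le> B)
                     \<and> \<theta> \<bullet> x0 \<le> \<theta>0
                     \<and> (\<exists>y. \<theta> \<bullet> y = \<theta>0 \<and> quad_cost c y x0 \<le> r)
                then {x0, xhat}
                else {x0}))
       \<and>
         (let xhat = (\<chi> i. (\<theta>0 - w \<theta> \<bullet> x0) / (\<Sum>j\<in>UNIV. (w \<theta> $ j)\<^sup>2 / c $ j)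
                             * (w \<theta> $ i / c $ i) + x0 $ i)
          in best_responses r B c x0 (w \<theta>) \<theta>0 =
               (if (\<exists>y. w \<theta> \<bullet> y = \<theta>0 \<and> (y - x0) \<bullet> (diag_matrix c *v (y - x0)) \<le> B)
                     \<and> w \<theta> \<bullet> x0 \<le> \<theta>0
                     \<and> (\<exists>y. w \<theta> \<bullet> y = \<theta>0 \<and> quad_cost c y x0 < r)
                then {xhat}
                else if (\<exists>y. w \<theta> \<bullet> y = \<theta>0 \<and> (y - x0) \<bullet> (diag_matrix c *v (y - x0)) \<le> B)
                     \<and> w \<theta> \<bullet> x0 \<le> \<theta>0
                     \<and> (\<exists>y. w \<theta> \<bullet> y = \<theta>0 \<and> quad_cost c y x0 \<le> r)
                then {x0, xhat}
                else {x0}))"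
  unfolding Let_def inner_diag_matrix_eq_quad_cost
  \<comment> \<open>The weight vector stays schematic, so one fact serves both
    \<open>\<theta>\<close> and \<open>w \<theta>\<close>.\<close>
  using best_responses_eq [OF assms(3-5), of x0 _ \<theta>0, unfolded weighted_proj_def]
  by (intro conjI) assumption+

end
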